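(* Let $G$ be a finite abelian group. Then the prime order element graph $\Gamma(G)$ is Laplacian integral, i.e. all eigenvalues of the Laplacian matrix of $\Gamma(G)$ are integers.
   Context: For a finite group $G$, the prime order element graph $\Gamma(G)$ is the simple undirected graph (no loops) with vertex set $G$ in which two distinct vertices $x,y\in G$ are adjacent if and only if the order of the product $xy$ is a prime number. The Laplacian matrix of a graph is $D-A$, where $D$ is the diagonal matrix of vertex degrees and $A$ is the adjacency matrix. A graph is called Laplacian integral if all the eigenvalues of its Laplacian matrix are integers. *)

theory Defs
  imports
    "HOL-Algebra.Multiplicative_Group"
    "HOL-Computational_Algebra.Primes"
    "Graph_Theory.Pair_Digraph"
    "Jordan_Normal_Form.Char_Poly"
begin

text \<open>
  A simple undirected graph is a symmetric, loop-free digraph without multiple arcs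
  (locale \<^locale>\<open>pair_graph\<close>), each edge being represented by its two orientations.
\<close>

definition prime_order_element_graph :: "('a, 'm) monoid_scheme \<Rightarrow> 'a pair_pre_digraph" where
  "prime_order_element_graph G =
    \<lparr> pverts = carrier G,
      parcs = {(x, y). x \<in> carrier G \<and> y \<in> carrier G \<and> x \<noteq> y \<and>
                       prime (group.ord G (x \<otimes>\<^bsub>G\<^esub> y))} \<rparr>"

lemma pair_graph_prime_order_element_graph:
  assumes "comm_group G" and "finite (carrier G)"
  shows "pair_graph (prime_order_element_graph G)"
proof -
  interpret comm_group G by fact
  let ?H = "prime_order_element_graph G"
  have "parcs ?H \<subseteq> carrier G \<times> carrier G"
    by (auto simp: prime_order_element_graph_def)
  then have "finite (parcs ?H)"
    using assms(2) finite_subset by blast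
  moreover have "symmetric (with_proj ?H)"
    by (auto simp: symmetric_def sym_def arcs_ends_conv prime_order_element_graph_def m_comm)
  ultimately show ?thesis
    using assms(2) by unfold_locales (auto simp: prime_order_element_graph_def)
qed

text \<open>
  The matrices below are taken with respect to an enumeration \<open>xs\<close> of the vertices.
  In an undirected graph in the above sense the degree of a vertex is its out-degree.
\<close>

definition degree_matrix :: "('a, 'b) pre_digraph \<Rightarrow> 'a list \<Rightarrow> complex mat" where
  "degree_matrix H xs = mat (length xs) (length xs)
     (\<lambda>(i, j). if i = j then of_nat (out_degree H (xs ! i)) else 0)"

definition adjacency_matrix :: "('a, 'b) pre_digraph \<Rightarrow> 'a list \<Rightarrow> complex mat" where
  "adjacency_matrix H xs = mat (length xs) (length xs)
     (\<lambda>(i, j). if (xs ! i, xs ! j) \<in> arcs_ends H then 1 else 0)"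

definition laplacian_matrix :: "('a, 'b) pre_digraph \<Rightarrow> 'a list \<Rightarrow> complex mat" where
  "laplacian_matrix H xs = degree_matrix H xs - adjacency_matrix H xs"

text \<open>
  The spectrum does not depend on the enumeration of the vertices, so quantifying over all
  enumerations amounts to choosing one. The notion is meant for finite graphs only: an infinite
  vertex set has no enumeration by a list.
\<close>

definition laplacian_integral :: "('a, 'b) pre_digraph \<Rightarrow> bool" where
  "laplacian_integral H \<longleftrightarrow>
    (\<forall>xs. distinct xs \<and> set xs = verts H \<longrightarrow>
      (\<forall>k. eigenvalue (laplacian_matrix H xs) k \<longrightarrow> k \<in> \<int>))"

end

theory Submission
  imports Defs
begin

text \<open>
  Let \<open>S\<close> be the set of elements of prime order. If loops are kept, the graph is the sum graph
  of \<open>S\<close>, which is regular of degree \<open>card S\<close>, and the loops cancel in the Laplacian. So it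
  suffices that the operator \<open>A f x = (\<Sum>s\<in>S. f (x\<inverse> s))\<close> has integral eigenvalues. As \<open>S\<close>
  is closed under inversion, \<open>A\<^sup>2 = C\<^sup>2\<close> for the translation operator
  \<open>C f x = (\<Sum>s\<in>S. f (x s))\<close>, so that every eigenvalue of \<open>A\<close> is up to sign one of \<open>C\<close>.
  Finally \<open>C + c\<close> is, for some integer \<open>c\<close>, the sum over primes \<open>p\<close> of the translation operators
  of the subgroups \<open>{x. x^p = 1}\<close>; these commute, and the one of a subgroup \<open>H\<close> has
  no eigenvalues besides \<open>0\<close> and \<open>card H\<close>.
\<close>

text \<open>For \<open>H\<close> closed under inversion this is the adjacency operator of a Cayley
  graph. Functions live on the whole type, so eigenvector equations are required on
  \<open>carrier G\<close> only.\<close>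

definition translation_sum :: "('a, 'm) monoid_scheme \<Rightarrow> 'a set \<Rightarrow> ('a \<Rightarrow> complex) \<Rightarrow> 'a \<Rightarrow> complex" where
  "translation_sum G H f x = (\<Sum>h\<in>H. f (x \<otimes>\<^bsub>G\<^esub> h))"

definition prime_order_elements :: "('a, 'm) monoid_scheme \<Rightarrow> 'a set" where
  "prime_order_elements G = {x \<in> carrier G. prime (group.ord G x)}"

context comm_group
begin

section \<open>Translation operators of subgroups\<close>

lemma translation_sum_commute:
  assumes "H \<subseteq> carrier G" "K \<subseteq> carrier G" "x \<in> carrier G"
  shows "translation_sum G H (translation_sum G K f) x = translation_sum G K (translation_sum G H f) x"
proof -
  have "translation_sum G H (translation_sum G K f) x = (\<Sum>h\<in>H. \<Sum>k\<in>K. f (x \<otimes> k \<otimes> h))"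
    unfolding translation_sum_def
  proof (intro sum.cong refl)
    fix h k assume "h \<in> H" "k \<in> K"
    then have "h \<in> carrier G" "k \<in> carrier G" using assms by auto
    then show "f (x \<otimes> h \<otimes> k) = f (x \<otimes> k \<otimes> h)" using assms(3) by (simp add: m_ac)
  qed
  also have "\<dots> = translation_sum G K (translation_sum G H f) x"
    unfolding translation_sum_def by (rule sum.swap)
  finally show ?thesis .
qed

text \<open>Multiplication by an element of \<open>H\<close> permutes \<open>H\<close>, so all inner
  sums agree.\<close>

lemma translation_sum_subgroup_idem:
  assumes "subgroup H G" "x \<in> carrier G"
  shows "translation_sum G H (translation_sum G H f) x = of_nat (card H) * translation_sum G H f x"
proof -
  have H: "H \<subseteq> carrier G" using assms(1) by (rule subgroup.subset)
  have "(\<Sum>k\<in>H. f (x \<otimes> h \<otimes> k)) = (\<Sum>k\<in>H. f (x \<otimes> k))" if h: "h \<in> H" for h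
  proof (rule sum.reindex_bij_witness[of _ "\<lambda>k. inv h \<otimes> k" "\<lambda>k. h \<otimes> k"])
    fix k assume k: "k \<in> H"
    have hc: "h \<in> carrier G" "k \<in> carrier G" using h k H by auto
    show "inv h \<otimes> (h \<otimes> k) = k" "h \<otimes> (inv h \<otimes> k) = k"
      using hc by (simp_all add: m_assoc[symmetric])
    show "h \<otimes> k \<in> H" "inv h \<otimes> k \<in> H"
      using h k assms(1) by (simp_all add: subgroup.m_closed subgroup.m_inv_closed)
    show "f (x \<otimes> (h \<otimes> k)) = f (x \<otimes> h \<otimes> k)"
      using hc assms(2) by (simp add: m_assoc)
  qed
  then show ?thesis unfolding translation_sum_def by simp
qed

text \<open>Induction replaces simultaneous diagonalisation. Split off the operator of
  \<open>H j\<close> and let \<open>g\<close> be the image of \<open>f\<close> under it. If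
  \<open>g\<close> vanishes, \<open>f\<close> is an eigenvector of the remaining sum for
  \<open>c\<close>; otherwise \<open>g\<close> is one for \<open>c - card (H j)\<close>.\<close>

lemma eigenvalue_sum_translation_sum_subgroups:
  assumes "finite I" and "\<And>i. i \<in> I \<Longrightarrow> subgroup (H i) G"
    and "\<And>x. x \<in> carrier G \<Longrightarrow> (\<Sum>i\<in>I. translation_sum G (H i) f x) = c * f x"
    and "\<exists>x\<in>carrier G. f x \<noteq> 0"
  shows "c \<in> \<int>"
  using assms
proof (induction I arbitrary: f c rule: finite_induct)
  case empty
  then have "c = 0" by auto
  then show ?case by simp
next
  case (insert j I)
  define g where "g = translation_sum G (H j) f"
  have Hj: "subgroup (H j) G" and HI: "\<And>i. i \<in> I \<Longrightarrow> subgroup (H i) G"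
    using insert.prems by auto
  have rest: "(\<Sum>i\<in>I. translation_sum G (H i) f x) = c * f x - g x" if "x \<in> carrier G" for x
    using insert.prems(2)[OF that] insert.hyps by (simp add: g_def algebra_simps)
  show ?case
  proof (cases "\<exists>x\<in>carrier G. g x \<noteq> 0")
    case False
    then show ?thesis using rest HI insert.prems(3) by (intro insert.IH[of f c]) auto
  next
    case True
    \<comment> \<open>Apply the operator of \<open>H j\<close> to both sides of \<open>rest\<close>:
      it commutes with the others and multiplies \<open>g\<close> by
      \<open>card (H j)\<close>.\<close>
    have "(\<Sum>i\<in>I. translation_sum G (H i) g x) = (c - of_nat (card (H j))) * g x"
      if x: "x \<in> carrier G" for x
    proof -
      have "(\<Sum>i\<in>I. translation_sum G (H i) g x)
          = (\<Sum>i\<in>I. translation_sum G (H j) (translation_sum G (H i) f) x)"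
        unfolding g_def using Hj HI x
        by (intro sum.cong refl translation_sum_commute) (auto dest: subgroup.subset)
      also have "\<dots> = (\<Sum>h\<in>H j. \<Sum>i\<in>I. translation_sum G (H i) f (x \<otimes> h))"
        unfolding translation_sum_def[of G "H j"] by (rule sum.swap)
      also have "\<dots> = (\<Sum>h\<in>H j. c * f (x \<otimes> h) - g (x \<otimes> h))"
        using x Hj by (intro sum.cong refl rest) (auto dest: subgroup.mem_carrier)
      also have "\<dots> = c * g x - translation_sum G (H j) g x"
        by (simp add: g_def translation_sum_def sum_subtractf sum_distrib_left)
      also have "translation_sum G (H j) g x = of_nat (card (H j)) * g x"
        unfolding g_def using Hj x by (rule translation_sum_subgroup_idem)
      finally show ?thesis by (simp add: algebra_simps)
    qed
    then have "c - of_nat (card (H j)) \<in> \<int>"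
      using True HI by (intro insert.IH[of g]) auto
    then have "c - of_nat (card (H j)) + of_nat (card (H j)) \<in> \<int>"
      by (intro Ints_add) auto
    then show ?thesis by simp
  qed
qed

section \<open>Elements of prime order\<close>

lemma subgroup_pow_eq_one: "subgroup {x \<in> carrier G. x [^] (n::nat) = \<one>} G"
  by (rule subgroupI) (auto simp: nat_pow_distrib nat_pow_inv)

text \<open>If \<open>x\<close> is not the identity and its \<open>p\<close>-th power is, then
  \<open>ord x\<close> divides the prime \<open>p\<close> and is not 1, so it equals
  \<open>p\<close>. Bounding \<open>p\<close> keeps the union finite and loses nothing, as
  \<open>ord x\<close> is at most the group order.\<close>

lemma prime_order_elements_eq:
  assumes "finite (carrier G)"
  shows "prime_order_elements G =
    (\<Union>p\<in>{p. prime p \<and> p \<le> Coset.order G}. {x \<in> carrier G. x [^] p = \<one>} - {\<one>})"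
proof -
  have "prime (ord x) \<longleftrightarrow> (\<exists>p. prime p \<and> p \<le> Coset.order G \<and> x [^] p = \<one> \<and> x \<noteq> \<one>)"
    if x: "x \<in> carrier G" for x
  proof
    assume "prime (ord x)"
    moreover have "ord x \<le> Coset.order G"
      using x assms by (simp add: ord_le_group_order)
    moreover have "x \<noteq> \<one>"
      using \<open>prime (ord x)\<close> by auto
    ultimately show "\<exists>p. prime p \<and> p \<le> Coset.order G \<and> x [^] p = \<one> \<and> x \<noteq> \<one>"
      using x pow_ord_eq_1 by blast
  next
    assume "\<exists>p. prime p \<and> p \<le> Coset.order G \<and> x [^] p = \<one> \<and> x \<noteq> \<one>"
    then obtain p :: nat where p: "prime p" "x [^] p = \<one>" "x \<noteq> \<one>" by blast
    then have "ord x dvd p" "ord x \<noteq> 1" using x by (simp_all only: pow_eq_id ord_eq_1 not_False_eq_True)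
    then show "prime (ord x)" using p(1) prime_nat_iff by blast
  qed
  then show ?thesis unfolding prime_order_elements_def by blast
qed

lemma eigenvalue_translation_sum_prime_order_elements:
  assumes fin: "finite (carrier G)"
    and eig: "\<And>x. x \<in> carrier G \<Longrightarrow> translation_sum G (prime_order_elements G) f x = c * f x"
    and nz: "\<exists>x\<in>carrier G. f x \<noteq> 0"
  shows "c \<in> \<int>"
proof -
  let ?P = "{p. prime p \<and> p \<le> Coset.order G}"
  let ?H = "\<lambda>p. {x \<in> carrier G. x [^] (p::nat) = \<one>}"
  have finP: "finite ?P" by simp
  have disj: "(?H p - {\<one>}) \<inter> (?H q - {\<one>}) = {}"
    if "p \<in> ?P" "q \<in> ?P" "p \<noteq> q" for p q
  proof -
    have cop: "coprime p q" using that by (auto intro: primes_coprime)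
    have "x = \<one>" if "x \<in> ?H p" "x \<in> ?H q" for x
    proof -
      have x: "x \<in> carrier G" "ord x dvd p" "ord x dvd q" using that by (auto simp: pow_eq_id[symmetric])
      then have "is_unit (ord x)" using cop by (blast intro: coprime_common_divisor)
      then show ?thesis using x(1) by (simp add: ord_eq_1[symmetric])
    qed
    then show ?thesis by blast
  qed
  \<comment> \<open>Putting the identity back into each of the disjoint pieces adds one
    \<open>f x\<close> per prime, which shifts the eigenvalue by \<open>card ?P\<close>.\<close>
  have "(\<Sum>p\<in>?P. translation_sum G (?H p) f x) = (c + of_nat (card ?P)) * f x"
    if x: "x \<in> carrier G" for x
  proof -
    have "translation_sum G (prime_order_elements G) f x = (\<Sum>p\<in>?P. \<Sum>h\<in>?H p - {\<one>}. f (x \<otimes> h))"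
      unfolding translation_sum_def prime_order_elements_eq[OF fin]
      using finP fin disj by (intro sum.UNION_disjoint) auto
    also have "\<dots> = (\<Sum>p\<in>?P. translation_sum G (?H p) f x - f x)"
      unfolding translation_sum_def using fin x by (intro sum.cong refl) (simp add: sum_diff1)
    finally show ?thesis using eig[OF x] by (simp add: sum_subtractf algebra_simps)
  qed
  then have "c + of_nat (card ?P) \<in> \<int>"
    using finP nz subgroup_pow_eq_one
    by (intro eigenvalue_sum_translation_sum_subgroups[of ?P ?H f]) auto
  then have "c + of_nat (card ?P) - of_nat (card ?P) \<in> \<int>"
    by (intro Ints_diff) auto
  then show ?thesis by simp
qed

section \<open>The operator with reflection\<close>

lemma reflected_translation_sum_twice:
  assumes S: "S \<subseteq> carrier G" "\<And>s. s \<in> S \<Longrightarrow> inv s \<in> S" and x: "x \<in> carrier G"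
  shows "translation_sum G S (\<lambda>y. translation_sum G S f (inv y)) (inv x)
       = translation_sum G S (translation_sum G S f) x"
  unfolding translation_sum_def
\<comment> \<open>The two reflections cancel up to inverting the outer summation variable, since
  \<open>inv (inv x \<otimes> s) = x \<otimes> inv s\<close>; \<open>S\<close> absorbs that
  inversion.\<close>
proof (rule sum.reindex_bij_witness[of _ "\<lambda>s. inv s" "\<lambda>s. inv s"])
  fix s assume s: "s \<in> S"
  then have sc: "s \<in> carrier G" using S by auto
  show "inv (inv s) = s" "inv (inv s) = s" "inv s \<in> S" "inv s \<in> S"
    using sc S s by auto
  show "(\<Sum>h\<in>S. f (x \<otimes> inv s \<otimes> h)) = (\<Sum>h\<in>S. f (inv (inv x \<otimes> s) \<otimes> h))"
    using sc x by (simp add: inv_mult)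
qed

text \<open>By the previous lemma \<open>(C - c) (C + c) f = 0\<close> on the group. So either
  \<open>g = (C + c) f\<close> is an eigenvector of \<open>C\<close> for \<open>c\<close>, or
  \<open>f\<close> is one for \<open>- c\<close>.\<close>

lemma eigenvalue_reflected_translation_sum:
  assumes fin: "finite (carrier G)"
    and eig: "\<And>x. x \<in> carrier G \<Longrightarrow> translation_sum G (prime_order_elements G) f (inv x) = c * f x"
    and nz: "\<exists>x\<in>carrier G. f x \<noteq> 0"
  shows "c \<in> \<int>"
proof -
  let ?S = "prime_order_elements G"
  define C where "C = translation_sum G ?S"
  have S: "?S \<subseteq> carrier G" "\<And>s. s \<in> ?S \<Longrightarrow> inv s \<in> ?S"
    by (auto simp: prime_order_elements_def ord_inv)
  have lin: "translation_sum G ?S (\<lambda>y. c * f y) x = c * C f x" for x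
    by (simp add: C_def translation_sum_def sum_distrib_left)
  have CC: "C (C f) x = c * (c * f x)" if x: "x \<in> carrier G" for x
  proof -
    have "C (C f) x = C (\<lambda>y. C f (inv y)) (inv x)"
      unfolding C_def using S x by (simp add: reflected_translation_sum_twice)
    also have "\<dots> = (\<Sum>h\<in>?S. c * f (inv x \<otimes> h))"
      unfolding C_def translation_sum_def[of _ _ "\<lambda>y. translation_sum G ?S f (inv y)"]
      using S x by (intro sum.cong refl eig) auto
    also have "\<dots> = c * (c * f x)"
      using eig[OF x] by (simp add: translation_sum_def sum_distrib_left[symmetric])
    finally show ?thesis .
  qed
  define g where "g x = C f x + c * f x" for x
  show ?thesis
  proof (cases "\<exists>x\<in>carrier G. g x \<noteq> 0")
    case True
    have "translation_sum G ?S g x = c * g x" if x: "x \<in> carrier G" for x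
    proof -
      have "translation_sum G ?S g x = C (C f) x + translation_sum G ?S (\<lambda>y. c * f y) x"
        by (simp add: translation_sum_def[of _ _ g] g_def sum.distrib
            translation_sum_def[of _ _ "C f"] translation_sum_def[of _ _ "\<lambda>y. c * f y"]
            C_def[THEN fun_cong, of "C f"])
      then show ?thesis using CC[OF x] lin[of x] by (simp add: g_def algebra_simps)
    qed
    then show ?thesis
      using eigenvalue_translation_sum_prime_order_elements[OF fin _ True] by blast
  next
    case False
    then have "translation_sum G ?S f x = (- c) * f x" if "x \<in> carrier G" for x
      using that by (simp add: g_def C_def add_eq_0_iff)
    then have "- c \<in> \<int>"
      using eigenvalue_translation_sum_prime_order_elements[OF fin _ nz] by blast
    then show ?thesis using Ints_minus by fastforce
  qed
qed

section \<open>From the Laplacian to the operator with reflection\<close>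

text \<open>A square of prime order contributes a loop on the right-hand side, which cancels.\<close>

lemma laplacian_prime_order_element_graph:
  fixes f :: "'a \<Rightarrow> complex"
  assumes fin: "finite (carrier G)" and x: "x \<in> carrier G"
  defines "\<Gamma> \<equiv> with_proj (prime_order_element_graph G)"
  shows "of_nat (out_degree \<Gamma> x) * f x - (\<Sum>y\<in>carrier G. if (x, y) \<in> arcs_ends \<Gamma> then f y else 0)
       = of_nat (card (prime_order_elements G)) * f x
         - translation_sum G (prime_order_elements G) f (inv x)"
proof -
  let ?S = "prime_order_elements G"
  define N where "N = {y \<in> carrier G. x \<otimes> y \<in> ?S}"
  have finN: "finite N" using fin by (simp add: N_def)
  have arc: "(x, y) \<in> arcs_ends \<Gamma> \<longleftrightarrow> y \<in> N - {x}" for y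
    using x by (auto simp: \<Gamma>_def N_def arcs_ends_conv prime_order_element_graph_def
        prime_order_elements_def)
  have "out_arcs \<Gamma> x = Pair x ` (N - {x})"
    using x by (auto simp: \<Gamma>_def N_def out_arcs_def prime_order_element_graph_def
        prime_order_elements_def)
  then have deg: "out_degree \<Gamma> x = card (N - {x})"
    by (simp add: out_degree_def card_image inj_on_def)
  have "(\<Sum>y\<in>carrier G. if (x, y) \<in> arcs_ends \<Gamma> then f y else 0) = sum f (N - {x})"
    unfolding arc using fin by (intro sum.mono_neutral_cong_right) (auto simp: N_def)
  moreover have "(of_nat (card (N - {x})) :: complex) * f x - sum f (N - {x}) = (\<Sum>y\<in>N - {x}. f x - f y)"
    by (simp add: sum_subtractf)
  \<comment> \<open>The possible loop \<open>y = x\<close> may be included because its term is zero.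
    Now \<open>N\<close> is the full translate of \<open>?S\<close> by \<open>inv x\<close>.\<close>
  moreover have "\<dots> = (\<Sum>y\<in>N. f x - f y)"
    using finN by (intro sum.mono_neutral_left) auto
  moreover have "\<dots> = (\<Sum>s\<in>?S. f x - f (inv x \<otimes> s))"
    using x by (intro sum.reindex_bij_witness[of _ "\<lambda>s. inv x \<otimes> s" "\<lambda>y. x \<otimes> y"])
      (auto simp: N_def prime_order_elements_def m_assoc[symmetric])
  ultimately show ?thesis
    by (simp add: deg sum_subtractf translation_sum_def)
qed

end

theorem theorem3p2:
  fixes G :: "('a, 'm) monoid_scheme"
  assumes "comm_group G" and "finite (carrier G)"
  shows "laplacian_integral (with_proj (prime_order_element_graph G))"
  unfolding laplacian_integral_def
proof (intro allI impI, elim conjE)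
  interpret comm_group G by fact
  let ?\<Gamma> = "with_proj (prime_order_element_graph G)"
  let ?S = "prime_order_elements G"
  fix xs k
  assume dist: "distinct xs" and "set xs = verts ?\<Gamma>"
    and ev: "eigenvalue (laplacian_matrix ?\<Gamma> xs) k"
  then have set: "set xs = carrier G" by (simp add: prime_order_element_graph_def)
  define n where "n = length xs"
  let ?L = "laplacian_matrix ?\<Gamma> xs"
  have bij: "bij_betw ((!) xs) {..<n} (carrier G)"
    using dist set by (auto simp: n_def intro: bij_betw_nth)
  obtain v where v: "v \<in> carrier_vec n" "v \<noteq> 0\<^sub>v n" "?L *\<^sub>v v = k \<cdot>\<^sub>v v"
    using ev by (auto simp: eigenvalue_def eigenvector_def laplacian_matrix_def
        degree_matrix_def adjacency_matrix_def n_def)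
  \<comment> \<open>The vector \<open>v\<close> read as a function on the group through the
    enumeration \<open>xs\<close>.\<close>
  define f where "f x = v $ inv_into {..<n} ((!) xs) x" for x
  have f: "f (xs ! i) = v $ i" if "i < n" for i
    using bij that by (simp add: f_def bij_betw_def inv_into_f_f)
  \<comment> \<open>Row \<open>i\<close> of the equation for \<open>v\<close>, with
    \<open>x = xs ! i\<close>: the Laplacian acts as \<open>card ?S\<close> minus the operator with
    reflection.\<close>
  have "translation_sum G ?S f (inv\<^bsub>G\<^esub> x) = (of_nat (card ?S) - k) * f x" if x: "x \<in> carrier G" for x
  proof -
    obtain i where i: "i < n" "x = xs ! i"
      using x unfolding set[symmetric] by (auto simp: n_def in_set_conv_nth)
    have "k * f x = (?L *\<^sub>v v) $ i" using v i f by simp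
    also have "\<dots> = (\<Sum>j<n. ?L $$ (i, j) * v $ j)"
      using v(1) i(1) by (auto simp: laplacian_matrix_def degree_matrix_def adjacency_matrix_def
          n_def scalar_prod_def atLeast0LessThan)
    also have "\<dots> = (\<Sum>j<n. (if i = j then of_nat (out_degree ?\<Gamma> x) * f x else 0)
        - (if (x, xs ! j) \<in> arcs_ends ?\<Gamma> then f (xs ! j) else 0))"
      using i f by (intro sum.cong refl) (auto simp: laplacian_matrix_def degree_matrix_def
          adjacency_matrix_def n_def algebra_simps)
    also have "\<dots> = of_nat (out_degree ?\<Gamma> x) * f x
        - (\<Sum>j<n. if (x, xs ! j) \<in> arcs_ends ?\<Gamma> then f (xs ! j) else 0)"
      using i(1) by (simp add: sum_subtractf)
    also have "(\<Sum>j<n. if (x, xs ! j) \<in> arcs_ends ?\<Gamma> then f (xs ! j) else 0)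
        = (\<Sum>y\<in>carrier G. if (x, y) \<in> arcs_ends ?\<Gamma> then f y else 0)"
      by (rule sum.reindex_bij_betw[OF bij])
    also have "of_nat (out_degree ?\<Gamma> x) * f x - \<dots>
        = of_nat (card ?S) * f x - translation_sum G ?S f (inv\<^bsub>G\<^esub> x)"
      using assms(2) x by (rule laplacian_prime_order_element_graph)
    finally show ?thesis by (simp add: algebra_simps)
  qed
  moreover have "\<exists>x\<in>carrier G. f x \<noteq> 0"
  proof -
    obtain i where "i < n" "v $ i \<noteq> 0" using v(1,2) eq_vecI[of v "0\<^sub>v n"] by auto
    then show ?thesis using f set by (intro bexI[of _ "xs ! i"]) (auto simp: n_def)
  qed
  ultimately have "of_nat (card ?S) - k \<in> \<int>"
    using assms(2) eigenvalue_reflected_translation_sum by blast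
  then have "of_nat (card ?S) - (of_nat (card ?S) - k) \<in> \<int>"
    by (intro Ints_diff) auto
  then show "k \<in> \<int>" by simp
qed

end
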